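(* Let $\gamma,\alpha\in(0,1)$, let $\mathcal{X}\subset\mathbb{R}$ be an interval, let $X_1,\dots,X_n\in\mathcal{X}$ be fixed numbers, and let $Y_1,\dots,Y_n$ be independent real random variables such that $Y_i$ has distribution function $F(\cdot\,|\,X_i)$, where $F(\cdot\,|\,x)$, $x\in\mathcal{X}$, are (unknown) distribution functions on $\mathbb{R}$. For $x\in\mathcal{X}$ let $Q_\gamma(x)$ be a $\gamma$-quantile of $F(\cdot\,|\,x)$. Let $\mathcal{B}$ be a family of compact intervals $B\subset\mathcal{X}$ with endpoints in $\{X_1,\dots,X_n\}$, and for each $m\in\{1,\dots,n\}$ let $c_\ell(m),c_u(m)\in\{0,1,\dots,m\}$ be integers such that $$\mathbb{P}\bigl(T_\ell(B)\ge c_\ell(N(B))\ \text{and}\ T_u(B)\ge c_u(N(B))\ \text{for all}\ B\in\mathcal{B}\bigr)\ \ge\ 1-\alpha ,$$ where $N(B)$, $T_\ell(B)$, $T_u(B)$ are defined in the context. Define, for $x\in\mathcal{X}$, $$L(x):=\sup_{B\in\mathcal{B}:\,\max(B)\le x} Y_{B:c_\ell(N(B))},\qquad U(x):=\inf_{B\in\mathcal{B}:\,\min(B)\ge x} Y_{B:N(B)+1-c_u(N(B))}.$$ If $Q_\gamma:\mathcal{X}\to\mathbb{R}$ is isotonic (non-decreasing), then $$\mathbb{P}\bigl(L(x)\le Q_\gamma(x)\le U(x)\ \text{for all}\ x\in\mathcal{X}\bigr)\ \ge\ 1-\alpha .$$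
   Context: A $\gamma$-quantile of a distribution function $F(\cdot\,|\,x)$ is a number $q$ with $F(q-\,|\,x)\le\gamma\le F(q\,|\,x)$, where $F(q-\,|\,x)$ is the left limit at $q$. For an interval $B\subset\mathcal{X}$, $N(B):=\#\{i: X_i\in B\}$. Let $\xi_1,\dots,\xi_n\in\{0,1\}$ be independent Bernoulli variables with $\mathbb{E}(\xi_i)=\gamma$, and $T_\ell(B):=\sum_{i:\,X_i\in B}\xi_i$, $T_u(B):=\sum_{i:\,X_i\in B}(1-\xi_i)$. For $B\in\mathcal{B}$, $Y_{B:1}\le Y_{B:2}\le\cdots\le Y_{B:N(B)}$ are the order statistics of the observations $Y_i$ with $X_i\in B$, and $Y_{B:0}:=-\infty$, $Y_{B:N(B)+1}:=\infty$. Conventions: $\sup(\emptyset):=-\infty$, $\inf(\emptyset):=\infty$; $L$ and $U$ take values in $[-\infty,\infty]$. The covariate values $X_i$ are treated as fixed (one conditions on them). *)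

theory Defs
  imports "HOL-Probability.Probability"
begin

definition distribution_function :: "(real \<Rightarrow> real) \<Rightarrow> bool" where
  "distribution_function G \<longleftrightarrow>
     mono G \<and> (\<forall>t. continuous (at_right t) G) \<and>
     (G \<longlongrightarrow> 0) at_bot \<and> (G \<longlongrightarrow> 1) at_top"

text \<open>For a distribution function the left limit exists by monotonicity, so \<open>Lim\<close> is well defined
  wherever this predicate is used.\<close>

definition is_quantile :: "real \<Rightarrow> (real \<Rightarrow> real) \<Rightarrow> real \<Rightarrow> bool" where
  "is_quantile \<gamma> G q \<longleftrightarrow> Lim (at_left q) G \<le> \<gamma> \<and> \<gamma> \<le> G q"

definition obs_in :: "nat \<Rightarrow> (nat \<Rightarrow> real) \<Rightarrow> real set \<Rightarrow> nat set" where
  "obs_in n X B = {i \<in> {1..n}. X i \<in> B}"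

definition N_obs :: "nat \<Rightarrow> (nat \<Rightarrow> real) \<Rightarrow> real set \<Rightarrow> nat" where
  "N_obs n X B = card (obs_in n X B)"

definition T_lower :: "nat \<Rightarrow> (nat \<Rightarrow> real) \<Rightarrow> (nat \<Rightarrow> real) \<Rightarrow> real set \<Rightarrow> real" where
  "T_lower n X \<xi> B = (\<Sum>i\<in>obs_in n X B. \<xi> i)"

definition T_upper :: "nat \<Rightarrow> (nat \<Rightarrow> real) \<Rightarrow> (nat \<Rightarrow> real) \<Rightarrow> real set \<Rightarrow> real" where
  "T_upper n X \<xi> B = (\<Sum>i\<in>obs_in n X B. 1 - \<xi> i)"

text \<open>List positions count from 0, order statistics from 1. The index \<open>0\<close> gives \<open>-\<infinity>\<close> and the index
  \<open>N_obs n X B + 1\<close> gives \<open>\<infinity>\<close>; larger indices are not used.\<close>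

definition order_stat ::
  "nat \<Rightarrow> (nat \<Rightarrow> real) \<Rightarrow> (nat \<Rightarrow> real) \<Rightarrow> real set \<Rightarrow> nat \<Rightarrow> ereal" where
  "order_stat n X Y B k =
     (if k = 0 then - \<infinity>
      else if k \<le> N_obs n X B
      then ereal (sorted_list_of_multiset (image_mset Y (mset_set (obs_in n X B))) ! (k - 1))
      else \<infinity>)"

text \<open>\<open>Sup B\<close> and \<open>Inf B\<close> are the maximum and minimum of the nonempty compact intervals \<open>B\<close>. In
  \<^typ>\<open>ereal\<close> the supremum of the empty set is \<open>-\<infinity>\<close> and its infimum is \<open>\<infinity>\<close>.\<close>

definition lower_bound ::
  "nat \<Rightarrow> (nat \<Rightarrow> real) \<Rightarrow> real set set \<Rightarrow> (nat \<Rightarrow> nat) \<Rightarrow> (nat \<Rightarrow> real) \<Rightarrow> real \<Rightarrow> ereal" where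
  "lower_bound n X \<B> c\<^sub>l Y x =
     (SUP B\<in>{B \<in> \<B>. Sup B \<le> x}. order_stat n X Y B (c\<^sub>l (N_obs n X B)))"

definition upper_bound ::
  "nat \<Rightarrow> (nat \<Rightarrow> real) \<Rightarrow> real set set \<Rightarrow> (nat \<Rightarrow> nat) \<Rightarrow> (nat \<Rightarrow> real) \<Rightarrow> real \<Rightarrow> ereal" where
  "upper_bound n X \<B> c\<^sub>u Y x =
     (INF B\<in>{B \<in> \<B>. x \<le> Inf B}. order_stat n X Y B (N_obs n X B + 1 - c\<^sub>u (N_obs n X B)))"

end

theory Submission
  imports Defs
begin

text \<open>
  Fix \<open>B\<close> in the family. The order statistic with index \<open>c\<^sub>l (N(B))\<close> is at most \<open>Q (max B)\<close> iff at
  least \<open>c\<^sub>l (N(B))\<close> of the observations in \<open>B\<close> are at most \<open>Q (max B)\<close>, and the one with index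
  \<open>N(B) + 1 - c\<^sub>u (N(B))\<close> is at least \<open>Q (min B)\<close> iff at least \<open>c\<^sub>u (N(B))\<close> of them are at least
  \<open>Q (min B)\<close> (\<open>order_stat_le_iff\<close>, \<open>le_order_stat_iff\<close>). As \<open>Q\<close> is isotonic, these two conditions
  for all \<open>B\<close> are equivalent to \<open>L \<le> Q \<le> U\<close>. Again because \<open>Q\<close> is isotonic, \<open>Q (min B) \<le> Q (X i) \<le> Q (max B)\<close>
  for \<open>X i \<in> B\<close>, so it suffices to bound from below the number of \<open>i\<close> with \<open>Y i \<le> Q (X i)\<close>, and the
  number of \<open>i\<close> with \<open>Y i \<ge> Q (X i)\<close>.

  If the laws of the \<open>Y i\<close> have no atoms, the indicators of \<open>Y i \<le> Q (X i)\<close> are distributed like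
  the \<open>\<xi> i\<close> and the claim follows. In general, \<open>P (Y i < Q (X i)) \<le> \<gamma> \<le> P (Y i \<le> Q (X i))\<close>, and an
  independent coin decides whether the event \<open>Y i = Q (X i)\<close> is counted; its success probability is
  chosen so that the total probability is \<open>\<gamma>\<close> (\<open>randomised_quantile_event\<close>). The resulting variables
  \<open>Z i\<close> are independent Bernoulli(\<open>\<gamma>\<close>), hence jointly distributed like the \<open>\<xi> i\<close>
  (\<open>zero_one_distr_unique\<close>, \<open>indep_vars_prob_eq\<close>), and \<open>1{Y i < Q (X i)} \<le> Z i \<le> 1{Y i \<le> Q (X i)}\<close>. As
  \<open>T_lower\<close> is increasing and \<open>T_upper\<close> is decreasing in the 0-1 vector, both counts are at
  least the values of \<open>T_lower\<close> and \<open>T_upper\<close> at \<open>Z\<close>. The coins need not exist on the given probability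
  space, so this comparison takes place on the product of the spaces \<open>law of Y i\<close> times \<open>coin i\<close>.
\<close>

section \<open>Laws of independent families\<close>

lemma (in prob_space) zero_one_distr_eq:
  fixes V :: "'a \<Rightarrow> real"
  assumes V: "V \<in> borel_measurable M" and V01: "\<And>\<omega>. \<omega> \<in> space M \<Longrightarrow> V \<omega> \<in> {0, 1}"
    and A: "A \<in> sets borel"
  shows "measure (distr M borel V) A
           = indicator A 0 + (indicator A 1 - indicator A 0) * expectation V"
proof -
  have "\<bar>V \<omega>\<bar> \<le> 1" if "\<omega> \<in> space M" for \<omega>
    using V01[OF that] by auto
  then have int: "integrable M V"
    using V by (intro integrable_const_bound[where B = 1]) auto
  have "measure (distr M borel V) A = expectation (\<lambda>\<omega>. indicator A (V \<omega>))"
    using V A by (subst integral_distr[symmetric, where N = borel]) auto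
  also have "\<dots> = expectation (\<lambda>\<omega>. indicator A 0 + (indicator A 1 - indicator A 0) * V \<omega>)"
  proof (intro Bochner_Integration.integral_cong refl)
    fix \<omega> assume "\<omega> \<in> space M"
    then have "V \<omega> = 0 \<or> V \<omega> = 1" using V01 by auto
    then show "indicator A (V \<omega>) = indicator A 0 + (indicator A 1 - indicator A 0) * V \<omega>"
      by (elim disjE) simp_all
  qed
  also have "\<dots> = indicator A 0 + (indicator A 1 - indicator A 0) * expectation V"
    using int by (simp add: prob_space)
  finally show ?thesis .
qed

lemma zero_one_distr_unique:
  fixes V :: "'a \<Rightarrow> real" and W :: "'b \<Rightarrow> real"
  assumes "prob_space M" "V \<in> borel_measurable M" "\<And>\<omega>. \<omega> \<in> space M \<Longrightarrow> V \<omega> \<in> {0, 1}"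
    and "prob_space N" "W \<in> borel_measurable N" "\<And>\<omega>. \<omega> \<in> space N \<Longrightarrow> W \<omega> \<in> {0, 1}"
    and "integral\<^sup>L M V = integral\<^sup>L N W"
  shows "distr M borel V = distr N borel W"
proof (rule measure_eqI)
  fix A assume "A \<in> sets (distr M borel V)"
  then have A: "A \<in> sets borel" by simp
  interpret V: prob_space "distr M borel V" by (intro prob_space.prob_space_distr assms)
  interpret W: prob_space "distr N borel W" by (intro prob_space.prob_space_distr assms)
  show "emeasure (distr M borel V) A = emeasure (distr N borel W) A"
    using prob_space.zero_one_distr_eq[OF assms(1,2,3) A]
      prob_space.zero_one_distr_eq[OF assms(4,5,6) A] assms(7)
    by (simp add: V.emeasure_eq_measure W.emeasure_eq_measure)
qed simp

text \<open>The joint law of a nonempty independent family is determined by its marginal laws, even when the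
  two families live on different probability spaces.\<close>

lemma indep_vars_prob_eq:
  fixes V :: "'i \<Rightarrow> 'a \<Rightarrow> 'c" and W :: "'i \<Rightarrow> 'b \<Rightarrow> 'c"
  assumes M: "prob_space M" "prob_space.indep_vars M (\<lambda>_. R) V I"
    and N: "prob_space N" "prob_space.indep_vars N (\<lambda>_. R) W I"
    and "I \<noteq> {}" and eq: "\<And>i. i \<in> I \<Longrightarrow> distr M R (V i) = distr N R (W i)"
    and S: "S \<in> sets (PiM I (\<lambda>_. R))"
  shows "measure M {\<omega> \<in> space M. (\<lambda>i\<in>I. V i \<omega>) \<in> S}
           = measure N {\<omega> \<in> space N. (\<lambda>i\<in>I. W i \<omega>) \<in> S}"
proof -
  have mV: "\<And>i. i \<in> I \<Longrightarrow> V i \<in> measurable M R" and mW: "\<And>i. i \<in> I \<Longrightarrow> W i \<in> measurable N R"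
    using M N by (auto simp: prob_space.indep_vars_def)
  have "distr M (PiM I (\<lambda>_. R)) (\<lambda>\<omega>. \<lambda>i\<in>I. V i \<omega>) = PiM I (\<lambda>i. distr M R (V i))"
    using prob_space.indep_vars_iff_distr_eq_PiM'[OF M(1) \<open>I \<noteq> {}\<close>, where M' = "\<lambda>_. R" and X = V] M(2) mV
    by auto
  also have "\<dots> = PiM I (\<lambda>i. distr N R (W i))"
    using eq by (intro PiM_cong) auto
  also have "\<dots> = distr N (PiM I (\<lambda>_. R)) (\<lambda>\<omega>. \<lambda>i\<in>I. W i \<omega>)"
    using prob_space.indep_vars_iff_distr_eq_PiM'[OF N(1) \<open>I \<noteq> {}\<close>, where M' = "\<lambda>_. R" and X = W] N(2) mW
    by auto
  finally have *: "measure (distr M (PiM I (\<lambda>_. R)) (\<lambda>\<omega>. \<lambda>i\<in>I. V i \<omega>)) S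
      = measure (distr N (PiM I (\<lambda>_. R)) (\<lambda>\<omega>. \<lambda>i\<in>I. W i \<omega>)) S"
    by simp
  have "(\<lambda>\<omega>. \<lambda>i\<in>I. V i \<omega>) \<in> measurable M (PiM I (\<lambda>_. R))"
    "(\<lambda>\<omega>. \<lambda>i\<in>I. W i \<omega>) \<in> measurable N (PiM I (\<lambda>_. R))"
    using mV mW by (auto intro!: measurable_restrict)
  with * S show ?thesis
    by (auto simp: measure_distr vimage_def Int_def conj_commute)
qed

lemma indep_vars_PiM_components:
  assumes "\<And>i. i \<in> I \<Longrightarrow> prob_space (K i)" "I \<noteq> {}"
  shows "prob_space.indep_vars (PiM I K) K (\<lambda>i w. w i) I"
proof -
  interpret prob_space "PiM I K" by (intro prob_space_PiM assms)
  have "distr (PiM I K) (PiM I K) (\<lambda>w. \<lambda>i\<in>I. w i) = distr (PiM I K) (PiM I K) (\<lambda>w. w)"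
    by (intro distr_cong) (auto simp: space_PiM PiE_def extensional_restrict)
  also have "\<dots> = PiM I K"
    by (simp add: distr_id2)
  also have "\<dots> = PiM I (\<lambda>i. distr (PiM I K) (K i) (\<lambda>w. w i))"
    by (intro PiM_cong refl distr_PiM_component[symmetric] assms)
  finally show ?thesis
    by (subst indep_vars_iff_distr_eq_PiM'[OF \<open>I \<noteq> {}\<close>]) auto
qed

section \<open>Randomised quantile events\<close>

text \<open>The success probability of the coin is \<open>(\<gamma> - \<mu> {..<q}) / \<mu> {q}\<close>. If \<open>q\<close> is not an atom, the quotient
  is \<open>0\<close> by the convention for division by zero, and \<open>\<mu> {..<q} = \<gamma>\<close> already.\<close>

lemma randomised_quantile_event:
  fixes \<mu> :: "real measure"
  assumes "real_distribution \<mu>" and "is_quantile \<gamma> (cdf \<mu>) q"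
  obtains p where "measure (\<mu> \<Otimes>\<^sub>M measure_pmf (bernoulli_pmf p))
      {z. fst z < q \<or> fst z = q \<and> snd z} = \<gamma>"
proof -
  interpret \<mu>: real_distribution \<mu> by fact
  have "Lim (at_left q) (cdf \<mu>) = measure \<mu> {..<q}"
    by (intro tendsto_Lim \<mu>.cdf_at_left) simp
  then have le: "measure \<mu> {..<q} \<le> \<gamma>" "\<gamma> \<le> measure \<mu> {..q}"
    using assms(2) by (auto simp: is_quantile_def cdf_def)
  have split: "measure \<mu> {..q} = measure \<mu> {..<q} + measure \<mu> {q}"
    by (subst \<mu>.finite_measure_Union[symmetric]) (auto intro!: arg_cong[where f = "measure \<mu>"])
  define p where "p = (\<gamma> - measure \<mu> {..<q}) / measure \<mu> {q}"
  have p01: "0 \<le> p" "p \<le> 1"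
    using le split by (auto simp: p_def divide_le_eq_1 divide_nonneg_nonneg not_less)
  have p: "measure \<mu> {..<q} + measure \<mu> {q} * p = \<gamma>"
    using le split by (auto simp: p_def)
  let ?b = "measure_pmf (bernoulli_pmf p)"
  interpret P: pair_prob_space \<mu> ?b ..
  have "{z. fst z < q \<or> fst z = q \<and> snd z} = {..<q} \<times> UNIV \<union> {q} \<times> {True}"
    by auto
  also have "measure (\<mu> \<Otimes>\<^sub>M ?b) \<dots>
      = measure (\<mu> \<Otimes>\<^sub>M ?b) ({..<q} \<times> UNIV) + measure (\<mu> \<Otimes>\<^sub>M ?b) ({q} \<times> {True})"
    by (intro P.finite_measure_Union pair_measureI) auto
  also have "measure (\<mu> \<Otimes>\<^sub>M ?b) ({..<q} \<times> UNIV) = measure \<mu> {..<q}"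
    by (simp add: measure_def measure_pmf.emeasure_pair_measure_Times)
  also have "measure (\<mu> \<Otimes>\<^sub>M ?b) ({q} \<times> {True}) = measure \<mu> {q} * p"
  proof -
    have "emeasure (\<mu> \<Otimes>\<^sub>M ?b) ({q} \<times> {True}) = emeasure \<mu> {q} * emeasure ?b {True}"
      by (rule measure_pmf.emeasure_pair_measure_Times) auto
    then show ?thesis
      using p01 by (simp only: measure_def enn2real_mult) (simp add: emeasure_pmf_single)
  qed
  also note p
  finally show thesis by (rule that)
qed

section \<open>Order statistics and counts\<close>

lemma sorted_nth_iff_less_length_filter:
  assumes "sorted xs" "j < length xs" and down: "\<And>x y. x \<le> y \<Longrightarrow> P y \<Longrightarrow> P x"
  shows "P (xs ! j) \<longleftrightarrow> j < length (filter P xs)"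
  using assms(1,2)
proof (induction xs arbitrary: j)
  case (Cons x xs)
  show ?case
  proof (cases "P x")
    case True
    then show ?thesis using Cons by (cases j) auto
  next
    case False
    then have "\<forall>y\<in>set (x # xs). \<not> P y" using Cons.prems(1) down by auto
    then show ?thesis using Cons.prems(2) by (metis filter_False list.size(3) not_less0 nth_mem)
  qed
qed simp

lemma finite_obs_in: "finite (obs_in n X B)"
  by (simp add: obs_in_def)

lemma T_lower_plus_T_upper: "T_lower n X v B + T_upper n X v B = real (N_obs n X B)"
  by (simp add: T_lower_def T_upper_def N_obs_def sum_subtractf)

lemma T_lower_mono:
  "(\<And>i. i \<in> obs_in n X B \<Longrightarrow> v i \<le> w i) \<Longrightarrow> T_lower n X v B \<le> T_lower n X w B"
  by (auto simp: T_lower_def intro: sum_mono)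

lemma T_upper_antimono:
  "(\<And>i. i \<in> obs_in n X B \<Longrightarrow> v i \<le> w i) \<Longrightarrow> T_upper n X w B \<le> T_upper n X v B"
  by (auto simp: T_upper_def intro: sum_mono)

lemma T_lower_measurable:
  assumes "\<And>i. i \<in> {1..n} \<Longrightarrow> (\<lambda>\<omega>. v \<omega> i) \<in> borel_measurable M"
  shows "(\<lambda>\<omega>. T_lower n X (v \<omega>) B) \<in> borel_measurable M"
  using assms unfolding T_lower_def by (intro borel_measurable_sum) (auto simp: obs_in_def)

lemma T_upper_measurable:
  assumes "\<And>i. i \<in> {1..n} \<Longrightarrow> (\<lambda>\<omega>. v \<omega> i) \<in> borel_measurable M"
  shows "(\<lambda>\<omega>. T_upper n X (v \<omega>) B) \<in> borel_measurable M"
  using assms unfolding T_upper_def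
  by (intro borel_measurable_sum borel_measurable_diff) (auto simp: obs_in_def)

lemma T_lower_indicator:
  "T_lower n X (\<lambda>i. indicator S (Y i)) B = real (card {i \<in> obs_in n X B. Y i \<in> S})"
  by (simp add: T_lower_def indicator_def sum.If_cases finite_obs_in Int_def)

text \<open>The downward closed predicate \<open>P\<close> covers both \<open>{..t}\<close> and \<open>{..<t}\<close>, which the two bounds need.\<close>

lemma order_stat_nth_iff:
  fixes P :: "real \<Rightarrow> bool"
  assumes k: "1 \<le> k" "k \<le> N_obs n X B" and down: "\<And>x y. x \<le> y \<Longrightarrow> P y \<Longrightarrow> P x"
  shows "P (sorted_list_of_multiset (image_mset Y (mset_set (obs_in n X B))) ! (k - 1))
           \<longleftrightarrow> real k \<le> T_lower n X (\<lambda>i. indicator {y. P y} (Y i)) B"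
proof -
  define xs where "xs = sorted_list_of_multiset (image_mset Y (mset_set (obs_in n X B)))"
  have mset: "mset xs = image_mset Y (mset_set (obs_in n X B))" by (simp add: xs_def)
  have sorted: "sorted xs" by (simp add: xs_def)
  have len: "length xs = N_obs n X B"
    using mset by (metis N_obs_def size_image_mset size_mset size_mset_set)
  have "length (filter P xs) = size (filter_mset P (mset xs))"
    by (metis mset_filter size_mset)
  also have "\<dots> = card {i \<in> obs_in n X B. P (Y i)}"
    by (simp add: mset filter_mset_image_mset filter_mset_mset_set finite_obs_in)
  also have "real \<dots> = T_lower n X (\<lambda>i. indicator {y. P y} (Y i)) B"
    by (simp add: T_lower_indicator)
  finally have count: "real (length (filter P xs)) = T_lower n X (\<lambda>i. indicator {y. P y} (Y i)) B" .
  have "P (xs ! (k - 1)) \<longleftrightarrow> k - 1 < length (filter P xs)"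
    by (rule sorted_nth_iff_less_length_filter[OF sorted _ down]) (use k len in auto)
  also have "\<dots> \<longleftrightarrow> real k \<le> real (length (filter P xs))" using k by auto
  finally show ?thesis by (simp only: count) (simp only: xs_def)
qed

lemma order_stat_le_iff:
  assumes "k \<le> N_obs n X B"
  shows "order_stat n X Y B k \<le> ereal t
           \<longleftrightarrow> real k \<le> T_lower n X (\<lambda>i. indicator {..t} (Y i)) B"
proof (cases "k = 0")
  case True
  then show ?thesis by (simp add: order_stat_def T_lower_def sum_nonneg)
next
  case False
  then show ?thesis
    using assms order_stat_nth_iff[of k n X B "\<lambda>y. y \<le> t" Y] 
    by (simp add: order_stat_def atMost_def)
qed

lemma le_order_stat_iff:
  assumes "c \<le> N_obs n X B"
  shows "ereal t \<le> order_stat n X Y B (N_obs n X B + 1 - c)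
           \<longleftrightarrow> real c \<le> T_upper n X (\<lambda>i. indicator {..<t} (Y i)) B"
proof (cases "c = 0")
  case True
  then show ?thesis by (simp add: order_stat_def T_upper_def sum_nonneg indicator_def)
next
  case False
  let ?N = "N_obs n X B" and ?below = "card {i \<in> obs_in n X B. Y i < t}"
  let ?xs = "sorted_list_of_multiset (image_mset Y (mset_set (obs_in n X B)))"
  have "ereal t \<le> order_stat n X Y B (?N + 1 - c) \<longleftrightarrow> \<not> ?xs ! (?N + 1 - c - 1) < t"
    using False assms by (auto simp: order_stat_def not_less)
  also have "?xs ! (?N + 1 - c - 1) < t \<longleftrightarrow> ?N + 1 - c \<le> ?below"
    using False assms order_stat_nth_iff[of "?N + 1 - c" n X B "\<lambda>y. y < t" Y]
    unfolding T_lower_indicator of_nat_le_iff by simp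
  also have "\<not> \<dots> \<longleftrightarrow> real c \<le> real ?N - real ?below"
    using assms by linarith
  also have "real ?N - real ?below = T_upper n X (\<lambda>i. indicator {..<t} (Y i)) B"
    using T_lower_plus_T_upper[of n X "\<lambda>i. indicator {..<t} (Y i)" B]
    by (simp add: T_lower_indicator)
  finally show ?thesis .
qed

section \<open>Coverage of the confidence band\<close>

theorem mainTheorem1:
  fixes \<gamma> \<alpha> :: real and n :: nat
    and \<X> :: "real set" and \<B> :: "real set set"
    and X :: "nat \<Rightarrow> real"
    and F :: "real \<Rightarrow> real \<Rightarrow> real" and Q :: "real \<Rightarrow> real"
    and M :: "'a measure" and Y :: "nat \<Rightarrow> 'a \<Rightarrow> real"
    and M' :: "'b measure" and \<xi> :: "nat \<Rightarrow> 'b \<Rightarrow> real"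
    and c\<^sub>l c\<^sub>u :: "nat \<Rightarrow> nat"
  assumes "0 < \<gamma>" "\<gamma> < 1" and "0 < \<alpha>" "\<alpha> < 1"
    and "is_interval \<X>"
    and "\<And>i. i \<in> {1..n} \<Longrightarrow> X i \<in> \<X>"
    and "\<And>x. x \<in> \<X> \<Longrightarrow> distribution_function (F x)"
    and "prob_space M"
    and "prob_space.indep_vars M (\<lambda>_. borel) Y {1..n}"
    and "\<And>i. i \<in> {1..n} \<Longrightarrow> cdf (distr M borel (Y i)) = F (X i)"
    and "\<And>x. x \<in> \<X> \<Longrightarrow> is_quantile \<gamma> (F x) (Q x)"
    and "\<And>B. B \<in> \<B> \<Longrightarrow>
           B \<subseteq> \<X> \<and> (\<exists>a\<in>X ` {1..n}. \<exists>b\<in>X ` {1..n}. a \<le> b \<and> B = {a..b})"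
    and "\<And>m. m \<in> {1..n} \<Longrightarrow> c\<^sub>l m \<le> m"
    and "\<And>m. m \<in> {1..n} \<Longrightarrow> c\<^sub>u m \<le> m"
    and "prob_space M'"
    and "prob_space.indep_vars M' (\<lambda>_. borel) \<xi> {1..n}"
    and "\<And>i \<omega>. i \<in> {1..n} \<Longrightarrow> \<omega> \<in> space M' \<Longrightarrow> \<xi> i \<omega> \<in> {0, 1}"
    and "\<And>i. i \<in> {1..n} \<Longrightarrow> integral\<^sup>L M' (\<xi> i) = \<gamma>"
    and "measure M' {\<omega> \<in> space M'. \<forall>B\<in>\<B>.
           T_lower n X (\<lambda>i. \<xi> i \<omega>) B \<ge> real (c\<^sub>l (N_obs n X B)) \<and>
           T_upper n X (\<lambda>i. \<xi> i \<omega>) B \<ge> real (c\<^sub>u (N_obs n X B))} \<ge> 1 - \<alpha>"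
    and "mono_on \<X> Q"
  shows "measure M {\<omega> \<in> space M. \<forall>x\<in>\<X>.
           lower_bound n X \<B> c\<^sub>l (\<lambda>i. Y i \<omega>) x \<le> ereal (Q x) \<and>
           ereal (Q x) \<le> upper_bound n X \<B> c\<^sub>u (\<lambda>i. Y i \<omega>) x} \<ge> 1 - \<alpha>"
proof -
  interpret M: prob_space M by fact
  interpret M': prob_space M' by fact
  note X = assms(6) and Q = assms(11) and \<B> = assms(12) and cl = assms(13) and cu = assms(14)
    and mono = assms(20)
  let ?I = "{1..n}"
  have fin\<B>: "finite \<B>"
  proof (rule finite_subset)
    show "\<B> \<subseteq> (\<lambda>(a, b). {a..b}) ` (X ` ?I \<times> X ` ?I)" using \<B> by fastforce
  qed auto
  have mY [measurable]: "Y i \<in> borel_measurable M" if "i \<in> ?I" for i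
    using assms(9) that by (auto simp: M.indep_vars_def)
  have m\<xi> [measurable]: "\<xi> i \<in> borel_measurable M'" if "i \<in> ?I" for i
    using assms(16) that by (auto simp: M'.indep_vars_def)
  have bounds: "Sup B \<in> \<X> \<and> Inf B \<in> \<X> \<and> (\<forall>y\<in>B. Inf B \<le> y \<and> y \<le> Sup B) \<and>
      c\<^sub>l (N_obs n X B) \<le> N_obs n X B \<and> c\<^sub>u (N_obs n X B) \<le> N_obs n X B" if B: "B \<in> \<B>" for B
  proof -
    obtain i b where ib: "i \<in> ?I" "X i \<le> b" "B = {X i..b}" "B \<subseteq> \<X>" using \<B>[OF B] by blast
    have "i \<in> obs_in n X B" using ib by (auto simp: obs_in_def)
    then have "1 \<le> N_obs n X B"
      unfolding N_obs_def by (metis One_nat_def Suc_leI card_gt_0_iff empty_iff finite_obs_in)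
    moreover have "N_obs n X B \<le> n"
    proof -
      have "obs_in n X B \<subseteq> ?I" by (auto simp: obs_in_def)
      from card_mono[OF _ this] show ?thesis by (simp add: N_obs_def)
    qed
    ultimately show ?thesis using cl cu ib by auto
  qed
  \<comment> \<open>As \<open>Q\<close> is isotonic, the constraint that \<open>B\<close> puts on \<open>L\<close> is tightest at \<open>x = Sup B\<close>, and the
     one that it puts on \<open>U\<close> is tightest at \<open>x = Inf B\<close>. This turns the uncountable intersection over
     \<open>x\<close> into a finite one over \<open>B\<close>, which also makes the event measurable.\<close>
  have event_iff: "(\<forall>x\<in>\<X>. lower_bound n X \<B> c\<^sub>l y x \<le> ereal (Q x) \<and>
                 ereal (Q x) \<le> upper_bound n X \<B> c\<^sub>u y x) \<longleftrightarrow>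
      (\<forall>B\<in>\<B>. real (c\<^sub>l (N_obs n X B)) \<le> T_lower n X (\<lambda>i. indicator {..Q (Sup B)} (y i)) B \<and>
             real (c\<^sub>u (N_obs n X B)) \<le> T_upper n X (\<lambda>i. indicator {..<Q (Inf B)} (y i)) B)"
    (is "?L \<longleftrightarrow> ?R") for y
  proof -
    have "?L \<longleftrightarrow> (\<forall>B\<in>\<B>. order_stat n X y B (c\<^sub>l (N_obs n X B)) \<le> ereal (Q (Sup B)) \<and>
        ereal (Q (Inf B)) \<le> order_stat n X y B (N_obs n X B + 1 - c\<^sub>u (N_obs n X B)))" (is "_ \<longleftrightarrow> ?S")
    proof
      assume ?L
      then show ?S using bounds by (auto simp: lower_bound_def upper_bound_def SUP_le_iff le_INF_iff)
    next
      assume S: ?S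
      show ?L
      proof (intro ballI conjI)
        fix x assume x: "x \<in> \<X>"
        show "lower_bound n X \<B> c\<^sub>l y x \<le> ereal (Q x)" unfolding lower_bound_def
        proof (rule SUP_least)
          fix B assume B: "B \<in> {B \<in> \<B>. Sup B \<le> x}"
          then have "Q (Sup B) \<le> Q x" using mono bounds x by (auto simp: mono_on_def)
          then show "order_stat n X y B (c\<^sub>l (N_obs n X B)) \<le> ereal (Q x)"
            using S B by (auto intro: order_trans)
        qed
        show "ereal (Q x) \<le> upper_bound n X \<B> c\<^sub>u y x" unfolding upper_bound_def
        proof (rule INF_greatest)
          fix B assume B: "B \<in> {B \<in> \<B>. x \<le> Inf B}"
          then have "Q x \<le> Q (Inf B)" using mono bounds x by (auto simp: mono_on_def)
          then show "ereal (Q x) \<le> order_stat n X y B (N_obs n X B + 1 - c\<^sub>u (N_obs n X B))"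
            using S B by (force intro: order_trans[of "ereal (Q x)" "ereal (Q (Inf B))"])
        qed
      qed
    qed
    also have "\<dots> \<longleftrightarrow> ?R"
      using bounds by (intro ball_cong refl) (simp only: order_stat_le_iff le_order_stat_iff)
    finally show ?thesis .
  qed

  \<comment> \<open>The condition on \<open>\<xi>\<close> with a separate 0-1 vector for each of the two counts; it is increasing in
     the first vector and decreasing in the second.\<close>
  define J where "J u v \<longleftrightarrow> (\<forall>B\<in>\<B>. real (c\<^sub>l (N_obs n X B)) \<le> T_lower n X u B \<and>
      real (c\<^sub>u (N_obs n X B)) \<le> T_upper n X v B)" for u v :: "nat \<Rightarrow> real"
  have J_mono: "J u' v'" if "J u v" "\<And>i. i \<in> ?I \<Longrightarrow> u i \<le> u' i" "\<And>i. i \<in> ?I \<Longrightarrow> v' i \<le> v i" for u v u' v'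
  proof -
    have "T_lower n X u B \<le> T_lower n X u' B" "T_upper n X v B \<le> T_upper n X v' B" for B
      using that by (auto intro!: T_lower_mono T_upper_antimono simp: obs_in_def)
    then show ?thesis using that(1) unfolding J_def by (meson order_trans)
  qed
  have J_measurable: "{\<omega> \<in> space N. J (u \<omega>) (v \<omega>)} \<in> sets N"
    if "\<And>i. i \<in> ?I \<Longrightarrow> (\<lambda>\<omega>. u \<omega> i) \<in> borel_measurable N"
      "\<And>i. i \<in> ?I \<Longrightarrow> (\<lambda>\<omega>. v \<omega> i) \<in> borel_measurable N"
    for N :: "'z measure" and u v
  proof -
    have [measurable]: "(\<lambda>\<omega>. T_lower n X (u \<omega>) B) \<in> borel_measurable N"
      "(\<lambda>\<omega>. T_upper n X (v \<omega>) B) \<in> borel_measurable N" for B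
      using that by (auto intro: T_lower_measurable T_upper_measurable)
    show ?thesis unfolding J_def using fin\<B> by measurable
  qed

  let ?E = "{\<omega> \<in> space M. \<forall>x\<in>\<X>. lower_bound n X \<B> c\<^sub>l (\<lambda>i. Y i \<omega>) x \<le> ereal (Q x) \<and>
      ereal (Q x) \<le> upper_bound n X \<B> c\<^sub>u (\<lambda>i. Y i \<omega>) x}"
  have E_sets: "?E \<in> sets M"
  proof -
    have [measurable]: "(\<lambda>\<omega>. T_lower n X (\<lambda>i. indicator {..a} (Y i \<omega>)) B) \<in> borel_measurable M"
      "(\<lambda>\<omega>. T_upper n X (\<lambda>i. indicator {..<a} (Y i \<omega>)) B) \<in> borel_measurable M" for a B
      by (auto intro!: T_lower_measurable T_upper_measurable)
    show ?thesis unfolding event_iff using fin\<B> by measurable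
  qed

  show ?thesis
  proof (cases "n = 0")
    case True
    \<comment> \<open>The comparison of laws below needs a nonempty index set.\<close>
    then have "\<B> = {}" using \<B> by auto
    then have "?E = space M" by (auto simp: lower_bound_def upper_bound_def)
    then show ?thesis using assms(3) by (simp only: M.prob_space)
  next
    case False
    then have I: "?I \<noteq> {}" by auto
    define \<mu> where "\<mu> i = distr M borel (Y i)" for i
    have \<mu>: "real_distribution (\<mu> i)" if "i \<in> ?I" for i
      using that unfolding \<mu>_def by (intro M.real_distribution_distr mY)
    have "\<exists>p. measure (\<mu> i \<Otimes>\<^sub>M measure_pmf (bernoulli_pmf p))
        {z. fst z < Q (X i) \<or> fst z = Q (X i) \<and> snd z} = \<gamma>" if "i \<in> ?I" for i
    proof -
      have "is_quantile \<gamma> (cdf (\<mu> i)) (Q (X i))"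
        using Q[OF X[OF that]] assms(10)[OF that] by (simp add: \<mu>_def)
      from randomised_quantile_event[OF \<mu>[OF that] this] show ?thesis by blast
    qed
    then have "\<forall>i\<in>?I. \<exists>p. measure (\<mu> i \<Otimes>\<^sub>M measure_pmf (bernoulli_pmf p))
        {z. fst z < Q (X i) \<or> fst z = Q (X i) \<and> snd z} = \<gamma>"
      by (rule ballI)
    from bchoice[OF this] obtain p where
      p: "\<forall>i\<in>?I. measure (\<mu> i \<Otimes>\<^sub>M measure_pmf (bernoulli_pmf (p i)))
        {z. fst z < Q (X i) \<or> fst z = Q (X i) \<and> snd z} = \<gamma>"
      by (rule exE)
    define K where "K i = \<mu> i \<Otimes>\<^sub>M measure_pmf (bernoulli_pmf (p i))" for i
    have K: "prob_space (K i)" if "i \<in> ?I" for i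
    proof -
      interpret real_distribution "\<mu> i" by (rule \<mu>[OF that])
      interpret pair_prob_space "\<mu> i" "measure_pmf (bernoulli_pmf (p i))" ..
      show ?thesis unfolding K_def by unfold_locales
    qed
    let ?P = "PiM ?I K"
    interpret P: prob_space ?P by (intro prob_space_PiM K)
    \<comment> \<open>\<open>Z\<close> is a Bernoulli(\<open>\<gamma>\<close>) copy of \<open>\<xi> i\<close>; an observation equal to \<open>Q (X i)\<close> is counted according
       to the coin.\<close>
    define Z where "Z i z = (indicator {z. fst z < Q (X i) \<or> fst z = Q (X i) \<and> snd z} z :: real)"
      for i and z :: "real \<times> bool"
    have sets_K: "sets (K i) = sets (borel \<Otimes>\<^sub>M count_space UNIV)" for i
      unfolding K_def \<mu>_def by (intro sets_pair_measure_cong) auto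
    have A_sets: "{z. fst z < Q (X i) \<or> fst z = Q (X i) \<and> snd z} \<in> sets (K i)" for i
    proof -
      have "{z \<in> space (borel \<Otimes>\<^sub>M count_space UNIV). fst z < Q (X i) \<or> fst z = Q (X i) \<and> snd z}
          \<in> sets (borel \<Otimes>\<^sub>M count_space UNIV)"
        by measurable
      then show ?thesis by (simp add: sets_K space_pair_measure)
    qed
    have mZ: "Z i \<in> borel_measurable (K i)" for i
      unfolding Z_def using A_sets by (intro borel_measurable_indicator)
    have mfst: "fst \<in> borel_measurable (K i)" for i
      by (simp add: measurable_cong_sets[OF sets_K refl])
    have coord: "P.indep_vars K (\<lambda>i w. w i) ?I"
      by (rule indep_vars_PiM_components[OF K I])
    have indep_fst: "P.indep_vars (\<lambda>_. borel) (\<lambda>i w. fst (w i)) ?I"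
      by (rule P.indep_vars_compose2[OF coord mfst])
    have indep_Z: "P.indep_vars (\<lambda>_. borel) (\<lambda>i w. Z i (w i)) ?I"
      by (rule P.indep_vars_compose2[OF coord mZ])
    have mcomp: "(\<lambda>w. f (w i)) \<in> borel_measurable ?P"
      if "i \<in> ?I" "f \<in> borel_measurable (K i)" for i and f :: "real \<times> bool \<Rightarrow> real"
      by (rule measurable_compose[OF measurable_component_singleton[OF that(1), of K] that(2)])
    have distr_comp: "distr ?P borel (\<lambda>w. f (w i)) = distr (K i) borel f"
      if "i \<in> ?I" "f \<in> borel_measurable (K i)" for i and f :: "real \<times> bool \<Rightarrow> real"
    proof -
      have "distr ?P borel (\<lambda>w. f (w i)) = distr (distr ?P (K i) (\<lambda>w. w i)) borel f"
        using that by (subst distr_distr) (auto simp: comp_def)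
      also have "distr ?P (K i) (\<lambda>w. w i) = K i"
        by (rule distr_PiM_component[OF K that(1)])
      finally show ?thesis .
    qed
    have law_Y: "distr M borel (Y i) = distr ?P borel (\<lambda>w. fst (w i))" if "i \<in> ?I" for i
    proof -
      have "distr (K i) borel fst = distr (K i) (\<mu> i) fst"
        by (intro distr_cong) (auto simp: \<mu>_def)
      also have "\<dots> = \<mu> i"
        unfolding K_def by (rule prob_space.distr_pair_fst) (rule prob_space_measure_pmf)
      finally show ?thesis using distr_comp[OF that mfst] by (simp add: \<mu>_def)
    qed
    have law_\<xi>: "distr M' borel (\<xi> i) = distr ?P borel (\<lambda>w. Z i (w i))" if "i \<in> ?I" for i
    proof -
      have "distr M' borel (\<xi> i) = distr (K i) borel (Z i)"
      proof (rule zero_one_distr_unique)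
        have "space (K i) = UNIV" by (simp add: K_def \<mu>_def space_pair_measure)
        then show "integral\<^sup>L M' (\<xi> i) = integral\<^sup>L (K i) (Z i)"
          using assms(18)[OF that] bspec[OF p that] by (simp add: Z_def[abs_def] K_def)
      qed (use that assms(17) m\<xi> K mZ M'.prob_space_axioms in \<open>auto simp: Z_def indicator_def\<close>)
      then show ?thesis using distr_comp[OF that mZ] by simp
    qed

    let ?R = "PiM ?I (\<lambda>_. borel :: real measure)"
    define lo where "lo y i = (indicator {..<Q (X i)} (y i) :: real)" for y i
    define hi where "hi y i = (indicator {..Q (X i)} (y i) :: real)" for y i
    have J_restrict: "J (restrict u ?I) (restrict v ?I) = J u v" for u v
      using J_mono[of u v "restrict u ?I" "restrict v ?I"]
        J_mono[of "restrict u ?I" "restrict v ?I" u v] by auto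
    let ?G = "{y \<in> space ?R. J (hi y) (lo y)}" and ?H = "{t \<in> space ?R. J t t}"
    have mproj [measurable]: "(\<lambda>y. y i) \<in> borel_measurable ?R" if "i \<in> ?I" for i
      using that by (rule measurable_component_singleton)
    have G: "?G \<in> sets ?R"
      by (rule J_measurable) (auto simp: lo_def hi_def)
    have H: "?H \<in> sets ?R"
      by (rule J_measurable) auto

    have "1 - \<alpha> \<le> measure M' {\<omega> \<in> space M'. J (\<lambda>i. \<xi> i \<omega>) (\<lambda>i. \<xi> i \<omega>)}"
      using assms(19) by (simp add: J_def)
    also have "\<dots> = measure M' {\<omega> \<in> space M'. (\<lambda>i\<in>?I. \<xi> i \<omega>) \<in> ?H}"
      by (simp add: J_restrict space_PiM del: One_nat_def)
    also have "\<dots> = measure ?P {w \<in> space ?P. (\<lambda>i\<in>?I. Z i (w i)) \<in> ?H}"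
      by (rule indep_vars_prob_eq[OF M'.prob_space_axioms assms(16)
            P.prob_space_axioms indep_Z I law_\<xi> H])
    also have "\<dots> = measure ?P {w \<in> space ?P. J (\<lambda>i. Z i (w i)) (\<lambda>i. Z i (w i))}"
      by (simp add: J_restrict space_PiM del: One_nat_def)
    \<comment> \<open>Pointwise, \<open>Z\<close> lies between \<open>lo\<close> and \<open>hi\<close> of the first components.\<close>
    also have "\<dots> \<le> measure ?P {w \<in> space ?P. J (hi (\<lambda>i. fst (w i))) (lo (\<lambda>i. fst (w i)))}"
    proof (rule P.finite_measure_mono)
      show "{w \<in> space ?P. J (\<lambda>i. Z i (w i)) (\<lambda>i. Z i (w i))}
          \<subseteq> {w \<in> space ?P. J (hi (\<lambda>i. fst (w i))) (lo (\<lambda>i. fst (w i)))}"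
        by (auto elim!: J_mono simp: Z_def hi_def lo_def indicator_def)
      show "{w \<in> space ?P. J (hi (\<lambda>i. fst (w i))) (lo (\<lambda>i. fst (w i)))} \<in> sets ?P"
        unfolding lo_def hi_def
        by (intro J_measurable measurable_compose[OF mcomp[OF _ mfst]]) simp_all
    qed
    also have "\<dots> = measure ?P {w \<in> space ?P. (\<lambda>i\<in>?I. fst (w i)) \<in> ?G}"
    proof -
      have "J (hi (restrict y ?I)) (lo (restrict y ?I)) = J (hi y) (lo y)" for y
        using J_mono[of "hi y" "lo y" "hi (restrict y ?I)" "lo (restrict y ?I)"]
          J_mono[of "hi (restrict y ?I)" "lo (restrict y ?I)" "hi y" "lo y"]
        by (auto simp: hi_def lo_def)
      then show ?thesis by (simp add: space_PiM del: One_nat_def)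
    qed
    also have "\<dots> = measure M {\<omega> \<in> space M. (\<lambda>i\<in>?I. Y i \<omega>) \<in> ?G}"
      by (rule indep_vars_prob_eq[OF M.prob_space_axioms assms(9)
            P.prob_space_axioms indep_fst I law_Y G, symmetric])
    also have "\<dots> \<le> measure M ?E"
    proof (rule M.finite_measure_mono)
      show "{\<omega> \<in> space M. (\<lambda>i\<in>?I. Y i \<omega>) \<in> ?G} \<subseteq> ?E"
      proof
        fix \<omega> assume \<omega>: "\<omega> \<in> {\<omega> \<in> space M. (\<lambda>i\<in>?I. Y i \<omega>) \<in> ?G}"
        have Jw: "J (hi (\<lambda>i\<in>?I. Y i \<omega>)) (lo (\<lambda>i\<in>?I. Y i \<omega>))" using \<omega> by simp
        have "real (c\<^sub>l (N_obs n X B)) \<le> T_lower n X (\<lambda>i. indicator {..Q (Sup B)} (Y i \<omega>)) B \<and>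
            real (c\<^sub>u (N_obs n X B)) \<le> T_upper n X (\<lambda>i. indicator {..<Q (Inf B)} (Y i \<omega>)) B"
          if B: "B \<in> \<B>" for B
        proof -
          \<comment> \<open>The second use of isotonicity: on \<open>B\<close>, the values \<open>Q (X i)\<close> lie between \<open>Q (Inf B)\<close> and
             \<open>Q (Sup B)\<close>.\<close>
          have Q_le: "Q (X i) \<le> Q (Sup B)" "Q (Inf B) \<le> Q (X i)" "i \<in> ?I" if "i \<in> obs_in n X B" for i
            using that bounds[OF B] mono X by (auto simp: obs_in_def mono_on_def)
          have "T_lower n X (hi (\<lambda>i\<in>?I. Y i \<omega>)) B
              \<le> T_lower n X (\<lambda>i. indicator {..Q (Sup B)} (Y i \<omega>)) B"
            using Q_le by (intro T_lower_mono) (fastforce simp: hi_def indicator_def)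
          moreover have "T_upper n X (lo (\<lambda>i\<in>?I. Y i \<omega>)) B
              \<le> T_upper n X (\<lambda>i. indicator {..<Q (Inf B)} (Y i \<omega>)) B"
            using Q_le by (intro T_upper_antimono) (fastforce simp: lo_def indicator_def)
          ultimately show ?thesis using Jw B unfolding J_def by (meson order_trans)
        qed
        then show "\<omega> \<in> ?E" using \<omega> by (simp only: mem_Collect_eq event_iff) blast
      qed
    qed (rule E_sets)
    finally show ?thesis .
  qed
qed

end
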